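(* Let $N\in\mathbb{R}^{n\times m}$ with $n\le m$, let $r\in[1,n]$ be real, and let $g:\mathbb{R}^{n\times m}\to\mathbb{R}\cup\{\infty\}$ be a closed, proper, convex, SDP-representable function such that $g(M)<\infty$ for some $M$ with $\mathrm{rank}(M)\le r$. Then the problem $$\min_{M\in\mathbb{R}^{n\times m}}\left[\tfrac12\|M\|_{r\ast}^2-\langle N,M\rangle+g(M)\right]$$ is equivalent to the problem $$\begin{aligned}&\underset{M,P,W}{\text{minimize}}&&\tfrac12\mathrm{trace}(W)-\mathrm{trace}(N^{\mathsf T}M)+g(M)\\ &\text{subject to}&&\begin{pmatrix} I-P & M \\ {M}^{\mathsf T} & W \end{pmatrix}\succeq0,\quad P\succeq0,\quad\mathrm{trace}(P)=n-r,\end{aligned}$$ where $M\in\mathbb{R}^{n\times m}$ and $P\in\mathbb{R}^{n\times n}$, $W\in\mathbb{R}^{m\times m}$ are symmetric; that is, both problems have the same optimal value, and $M^\star$ is a minimizer of the first problem if and only if there exist $P^\star,W^\star$ such that $(M^\star,P^\star,W^\star)$ is a minimizer of the second.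
   Context: Matrices are real, with $n\le m$; $\sigma_1(X)\ge\dots\ge\sigma_n(X)\ge 0$ are the singular values of $X\in\mathbb{R}^{n\times m}$ counted with multiplicity. $\langle X,Y\rangle=\mathrm{trace}(X^{\mathsf T}Y)$. For real $r\in[1,n]$, $$\|M\|_r:=\sqrt{\sum_{i=1}^{\lfloor r\rfloor}\sigma_i^2(M)+(r-\lfloor r\rfloor)\,\sigma_{\lceil r\rceil}^2(M)},$$ and $\|M\|_{r\ast}:=\max_{\|X\|_r\le1}\langle M,X\rangle$ is its dual norm. $A\succeq0$ means that $A$ is symmetric positive semidefinite. A function is closed, proper, convex if its epigraph is closed, non-empty, convex respectively; it is SDP-representable if its epigraph is the projection of a set described by a linear matrix inequality. *)

theory Defs
  imports "HOL-Analysis.Analysis" "HOL-Computational_Algebra.Polynomial"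
begin

(* An n x m real matrix has type real^'m^'n, with n = CARD('n) and m = CARD('m). *)

definition frob_inner :: "real^'m^'n \<Rightarrow> real^'m^'n \<Rightarrow> real" where
  "frob_inner X Y = trace (transpose X ** Y)"

definition psd :: "real^'k^'k \<Rightarrow> bool" where
  "psd A \<longleftrightarrow> transpose A = A \<and> (\<forall>x. 0 \<le> x \<bullet> (A *v x))"

definition block_matrix ::
  "'a^'n^'n \<Rightarrow> 'a^'m^'n \<Rightarrow> 'a^'n^'m \<Rightarrow> 'a^'m^'m \<Rightarrow> 'a^('n + 'm)^('n + 'm)" where
  "block_matrix A B C D = (\<chi> i j.
     (case i of
        Inl a \<Rightarrow> (case j of Inl b \<Rightarrow> A $ a $ b | Inr b \<Rightarrow> B $ a $ b)
      | Inr a \<Rightarrow> (case j of Inl b \<Rightarrow> C $ a $ b | Inr b \<Rightarrow> D $ a $ b)))"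

definition charpoly :: "real^'n^'n \<Rightarrow> real poly" where
  "charpoly A = det (\<chi> i j. (if i = j then [:0, 1:] else 0) - [:A $ i $ j:])"

(* Square roots of the eigenvalues of X X^T, with multiplicity and in nonincreasing order.
   X X^T is n x n, so the list has length n; for n \<le> m these are all the singular values. *)
definition singular_values :: "real^'m^'n \<Rightarrow> real list" where
  "singular_values X =
     rev (sorted_list_of_multiset (image_mset sqrt (proots (charpoly (X ** transpose X)))))"

(* Indexed from 1; used only for 1 \<le> i \<le> n. *)
definition sigma :: "nat \<Rightarrow> real^'m^'n \<Rightarrow> real" where
  "sigma i X = singular_values X ! (i - 1)"

definition r_norm :: "real \<Rightarrow> real^'m^'n \<Rightarrow> real" where
  "r_norm r M =
     sqrt ((\<Sum>i = 1..nat \<lfloor>r\<rfloor>. (sigma i M)\<^sup>2)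
           + (r - of_int \<lfloor>r\<rfloor>) * (sigma (nat \<lceil>r\<rceil>) M)\<^sup>2)"

(* The maximum over the unit ball of r_norm r, written as a supremum. *)
definition r_dual_norm :: "real \<Rightarrow> real^'m^'n \<Rightarrow> real" where
  "r_dual_norm r M = (SUP X \<in> {X. r_norm r X \<le> 1}. frob_inner M X)"

(* The library's epigraph is for real-valued functions only. *)
definition ext_epigraph :: "('e \<Rightarrow> ereal) \<Rightarrow> ('e \<times> real) set" where
  "ext_epigraph g = {(x, t). g x \<le> ereal t}"

(* The sizes of the matrix inequality and of the lifting are existentially quantified in
   sdp_set, so p x p matrices are given by their entries with indices below p. *)
definition sym_upto :: "nat \<Rightarrow> (nat \<Rightarrow> nat \<Rightarrow> real) \<Rightarrow> bool" where
  "sym_upto p A \<longleftrightarrow> (\<forall>i<p. \<forall>j<p. A i j = A j i)"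

definition psd_upto :: "nat \<Rightarrow> (nat \<Rightarrow> nat \<Rightarrow> real) \<Rightarrow> bool" where
  "psd_upto p A \<longleftrightarrow> sym_upto p A \<and>
     (\<forall>x :: nat \<Rightarrow> real. 0 \<le> (\<Sum>i<p. \<Sum>j<p. x i * A i j * x j))"

(* S is the projection onto x of the set of all (x, u), u in R^k, that satisfy a linear matrix
   inequality A0 + L(x) + u_0 B_0 + ... + u_(k-1) B_(k-1) \<succeq> 0 with symmetric p x p data. *)
definition sdp_set :: "'e::real_vector set \<Rightarrow> bool" where
  "sdp_set S \<longleftrightarrow>
     (\<exists>(p::nat) (k::nat) (A0 :: nat \<Rightarrow> nat \<Rightarrow> real) (L :: 'e \<Rightarrow> nat \<Rightarrow> nat \<Rightarrow> real)
        (B :: nat \<Rightarrow> nat \<Rightarrow> nat \<Rightarrow> real).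
        sym_upto p A0 \<and> (\<forall>x. sym_upto p (L x)) \<and> (\<forall>l<k. sym_upto p (B l)) \<and>
        (\<forall>i<p. \<forall>j<p. linear (\<lambda>x. L x i j)) \<and>
        S = {x. \<exists>u :: nat \<Rightarrow> real. psd_upto p (\<lambda>i j. A0 i j + L x i j + (\<Sum>l<k. u l * B l i j))})"

definition sdp_representable :: "('e::real_vector \<Rightarrow> ereal) \<Rightarrow> bool" where
  "sdp_representable g \<longleftrightarrow> sdp_set (ext_epigraph g)"

definition norm_objective ::
  "real^'m^'n \<Rightarrow> real \<Rightarrow> (real^'m^'n \<Rightarrow> ereal) \<Rightarrow> real^'m^'n \<Rightarrow> ereal" where
  "norm_objective N r g M = ereal (1/2 * (r_dual_norm r M)\<^sup>2 - frob_inner N M) + g M"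

definition sdp_objective ::
  "real^'m^'n \<Rightarrow> (real^'m^'n \<Rightarrow> ereal) \<Rightarrow> ((real^'m^'n) \<times> (real^'n^'n) \<times> (real^'m^'m)) \<Rightarrow> ereal" where
  "sdp_objective N g =
     (\<lambda>(M, P, W). ereal (1/2 * trace W - trace (transpose N ** M)) + g M)"

definition sdp_feasible :: "real \<Rightarrow> ((real^'m^'n) \<times> (real^'n^'n) \<times> (real^'m^'m)) \<Rightarrow> bool" where
  "sdp_feasible r =
     (\<lambda>(M, P, W). transpose P = P \<and> transpose W = W \<and>
        psd (block_matrix (mat 1 - P) M (transpose M) W) \<and>
        psd P \<and> trace P = real CARD('n) - r)"

end

theory Submission
  imports Defs
begin

text \<open>
The term \<open>g\<close> and the linear term are the same in both problems, so everything follows from one identity: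
for fixed \<open>M\<close>, the smallest value of \<open>trace W\<close> over all feasible \<open>(M, P, W)\<close> is attained and equals the
square of the dual norm of \<open>M\<close>. Write \<open>Q = I - P\<close>; feasibility says that \<open>0 \<preceq> Q \<preceq> I\<close>, that
\<open>trace Q = r\<close>, and that the block matrix with blocks \<open>Q, M, M\<^sup>T, W\<close> is positive semidefinite.

No feasible \<open>W\<close> can do better (\<open>feasible_bounds\<close>). Evaluating the block matrix on the columns of \<open>X\<close>,
paired with multiples of unit vectors, gives
\<open>\<langle>M, X\<rangle>\<^sup>2 \<le> trace (X\<^sup>T Q X) * trace W\<close>, and a Ky Fan type inequality bounds \<open>trace (X\<^sup>T Q X)\<close>
by the square of the r-norm of \<open>X\<close>.

Conversely (\<open>feasible_attaining_dual_norm\<close>), diagonalize \<open>M M\<^sup>T\<close> in an orthonormal frame, with eigenvalues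
\<open>s\<^sub>i\<^sup>2\<close>, and let \<open>Q\<close> be diagonal in that frame with entries \<open>q\<^sub>i = min 1 (s\<^sub>i / l)\<close>, where the
water level \<open>l\<close> is chosen such that the \<open>q\<^sub>i\<close> sum to \<open>r\<close>; if the rank of \<open>M\<close> is at most \<open>r\<close>, all positive
\<open>s\<^sub>i\<close> get \<open>q\<^sub>i = 1\<close> and the rest of the weight goes to the zero eigenvalues. Then \<open>W = M\<^sup>T Q\<^sup>+ M\<close> is
feasible by a Schur complement computation in coordinates, and \<open>X = Q\<^sup>+ M\<close>, scaled to have r-norm at most
one, shows that the dual norm is at least the square root of \<open>trace W\<close>.

Both halves handle the r-norm through the variational formula
\<open>\<parallel>X\<parallel>\<^sub>r\<^sup>2 = min\<^sub>t (r t + \<Sum>\<^sub>i max 0 (d\<^sub>i - t))\<close>, where the \<open>d\<^sub>i\<close> are the eigenvalues of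
\<open>X X\<^sup>T\<close>. The formula is symmetric in the eigenvalues, so after it is proved their ordering can be forgotten
and no singular value decomposition is needed.
\<close>

section \<open>Spectral theorem for real symmetric matrices\<close>

text \<open>A nonnegative quadratic polynomial that vanishes at the origin has its minimum there. This is the
first-order optimality condition for the Rayleigh quotient below.\<close>

lemma linear_coefficient_zero:
  fixes a b :: real
  assumes "\<And>t. 0 \<le> 2 * t * a + t\<^sup>2 * b"
  shows "a = 0"
proof -
  have b: "0 \<le> b" using assms[of 1] assms[of "-1"] by simp
  define s where "s = - a / (b + 1)"
  have a: "a = - s * (b + 1)" using b by (simp add: s_def field_simps)
  have "0 \<le> 2 * s * a + s\<^sup>2 * b" by (rule assms)
  also have "\<dots> = - (s\<^sup>2 * (b + 2))"
    by (simp add: a algebra_simps power2_eq_square)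
  finally have "s = 0" using b by (simp add: mult_le_0_iff)
  then show ?thesis by (simp add: a)
qed

text \<open>A maximizer \<open>v\<close> of the Rayleigh quotient on the unit sphere of \<open>S\<close>, with maximum \<open>\<mu>\<close>, is an eigenvector:
the quadratic form \<open>\<mu> y\<bullet>y - y\<bullet>f y\<close> is nonnegative on \<open>S\<close> and vanishes at \<open>v\<close>, so its derivative at \<open>v\<close>,
twice \<open>w = \<mu> v - f v\<close>, is orthogonal to all of \<open>S\<close>, in particular to \<open>w\<close> itself.\<close>

lemma eigenvector_in_invariant_subspace:
  fixes f :: "'a::euclidean_space \<Rightarrow> 'a"
  assumes "linear f" and sa: "\<And>x y. f x \<bullet> y = x \<bullet> f y"
    and S: "subspace S" and inv: "\<And>x. x \<in> S \<Longrightarrow> f x \<in> S"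
    and "x0 \<in> S" "x0 \<noteq> 0"
  obtains v \<mu> where "v \<in> S" "norm v = 1" "f v = \<mu> *\<^sub>R v"
proof -
  interpret f: linear f by fact
  have "compact (S \<inter> sphere 0 1)"
    using closed_subspace[OF S] by (simp add: closed_Int_compact)
  moreover have "(1 / norm x0) *\<^sub>R x0 \<in> S \<inter> sphere 0 1"
    using assms by (simp add: subspace_scale)
  then have "S \<inter> sphere 0 1 \<noteq> {}" by blast
  moreover have "continuous_on (S \<inter> sphere 0 1) (\<lambda>x. x \<bullet> f x)"
    using \<open>linear f\<close> by (intro continuous_intros linear_continuous_on linear_linear[THEN iffD1])
      (simp_all add: linear_conv_bounded_linear)
  ultimately obtain v where v: "v \<in> S \<inter> sphere 0 1"
    and max: "\<forall>y\<in>S \<inter> sphere 0 1. y \<bullet> f y \<le> v \<bullet> f v"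
    using continuous_attains_sup[of "S \<inter> sphere 0 1" "\<lambda>x. x \<bullet> f x"] by metis
  have v: "v \<in> S" "norm v = 1" using v by simp_all
  have max: "y \<bullet> f y \<le> v \<bullet> f v" if "y \<in> S" "norm y = 1" for y
    using max that by simp
  define \<mu> where "\<mu> = v \<bullet> f v"
  have nonneg: "0 \<le> \<mu> * (y \<bullet> y) - y \<bullet> f y" if "y \<in> S" for y
  proof (cases "y = 0")
    case False
    have "((1 / norm y) *\<^sub>R y) \<bullet> f ((1 / norm y) *\<^sub>R y) \<le> \<mu>"
      unfolding \<mu>_def using False that S by (intro max) (simp_all add: subspace_scale)
    then show ?thesis
      using False by (simp add: f.scale field_simps power2_norm_eq_inner flip: power2_eq_square)
  qed (simp add: f.zero)
  define w where "w = \<mu> *\<^sub>R v - f v"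
  have w: "w \<in> S" unfolding w_def using v S inv by (simp add: subspace_diff subspace_scale)
  have "v \<bullet> v = 1" using v by (simp add: dot_square_norm)
  have "w \<bullet> w = 0"
  proof (rule linear_coefficient_zero)
    fix t
    have "0 \<le> \<mu> * ((v + t *\<^sub>R w) \<bullet> (v + t *\<^sub>R w)) - (v + t *\<^sub>R w) \<bullet> f (v + t *\<^sub>R w)"
      using v w S by (intro nonneg) (simp add: subspace_add subspace_scale)
    also have "\<dots> = 2 * t * ((\<mu> *\<^sub>R v - f v) \<bullet> w) + t\<^sup>2 * (\<mu> * (w \<bullet> w) - w \<bullet> f w)"
      using \<open>v \<bullet> v = 1\<close> sa[of v w]
      by (simp add: f.add f.scale inner_add inner_diff_left \<mu>_def inner_commute algebra_simps
          power2_eq_square)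
    finally show "0 \<le> 2 * t * (w \<bullet> w) + t\<^sup>2 * (\<mu> * (w \<bullet> w) - w \<bullet> f w)"
      by (simp flip: w_def)
  qed
  then have "f v = \<mu> *\<^sub>R v" by (simp add: w_def)
  with v show ?thesis by (rule that)
qed

definition orthonormal_frame :: "('n \<Rightarrow> real^'n) \<Rightarrow> bool" where
  "orthonormal_frame u \<longleftrightarrow> (\<forall>i j. u i \<bullet> u j = (if i = j then 1 else 0))"

text \<open>The spectral theorem. An orthonormal set of eigenvectors of maximal size must span: otherwise its
orthogonal complement is a nonzero invariant subspace, which contains a further eigenvector.\<close>

lemma symmetric_matrix_eigenframe:
  fixes A :: "real^'n^'n"
  assumes "transpose A = A"
  obtains u d where "orthonormal_frame u" "\<And>i. A *v u i = d i *\<^sub>R u i"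
proof -
  define good where "good B \<longleftrightarrow> pairwise orthogonal B \<and>
    (\<forall>b\<in>B. norm b = 1 \<and> (\<exists>\<mu>. A *v b = \<mu> *\<^sub>R b))" for B :: "(real^'n) set"
  have good_indep: "independent B" if "good B" for B
    using that by (intro pairwise_orthogonal_independent) (auto simp: good_def)
  have bound: "card B < CARD('n) + 1" if "good B" for B
    using independent_bound[OF good_indep[OF that]] by simp
  have "good {}" by (simp add: good_def)
  then obtain B where B: "good B" and max: "\<And>C. good C \<Longrightarrow> card C \<le> card B"
    using ex_has_greatest_nat[of good "{}" card "CARD('n) + 1"] bound by (metis less_imp_le)
  have fin: "finite B" using independent_bound[OF good_indep[OF B]] by simp
  have sa: "(A *v x) \<bullet> y = x \<bullet> (A *v y)" for x y
    using dot_lmul_matrix[of x A y] assms by (metis transpose_matrix_vector)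
  have "span B = UNIV"
  proof (rule ccontr)
    assume "span B \<noteq> UNIV"
    then obtain x0 where x0: "x0 \<noteq> 0" "\<And>y. y \<in> span B \<Longrightarrow> orthogonal x0 y"
      using span_not_UNIV_orthogonal[of B] by (metis orthogonal_def inner_commute)
    define S where "S = {x. \<forall>b\<in>B. b \<bullet> x = 0}"
    have "subspace S" by (auto simp: S_def subspace_def inner_add_right)
    moreover have "A *v x \<in> S" if "x \<in> S" for x
      using that B by (auto simp: S_def good_def sa[symmetric])
    moreover have "x0 \<in> S" using x0 by (auto simp: S_def orthogonal_def span_base inner_commute)
    ultimately obtain v \<mu> where v: "v \<in> S" "norm v = 1" "A *v v = \<mu> *\<^sub>R v"
      using eigenvector_in_invariant_subspace[of "(*v) A" S x0] sa x0(1) by auto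
    have "v \<notin> B" using v by (auto simp: S_def dot_square_norm)
    have "good (insert v B)"
      using B v unfolding good_def
      by (auto simp: pairwise_insert orthogonal_def S_def inner_commute)
    from max[OF this] show False using \<open>v \<notin> B\<close> fin by simp
  qed
  then have "card B = CARD('n)"
    using dim_span_eq_card_independent[OF good_indep[OF B]] by (simp add: dim_UNIV)
  then obtain u where u: "bij_betw u (UNIV :: 'n set) B"
    using finite_same_card_bij[OF finite fin] by auto
  have uB: "u i \<in> B" for i using u by (auto simp: bij_betw_def)
  have "u i \<bullet> u j = (if i = j then 1 else 0)" for i j
  proof (cases "i = j")
    case True
    then show ?thesis using B uB by (auto simp: good_def dot_square_norm)
  next
    case False
    then have "u i \<noteq> u j" using u by (auto simp: bij_betw_def inj_def)
    then show ?thesis using B uB False by (auto simp: good_def pairwise_def orthogonal_def)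
  qed
  moreover have "\<forall>i. \<exists>\<mu>. A *v u i = \<mu> *\<^sub>R u i" using B uB by (auto simp: good_def)
  then obtain d where "\<And>i. A *v u i = d i *\<^sub>R u i" by metis
  ultimately show ?thesis by (intro that[of u d]) (auto simp: orthonormal_frame_def)
qed

section \<open>Computing in an orthonormal frame\<close>

lemma orthonormal_frame_matrix:
  assumes "orthonormal_frame u"
  shows "orthogonal_matrix (\<chi> i. u i)"
  using assms
  by (auto simp: orthonormal_frame_def orthogonal_matrix_orthonormal_rows row_def norm_eq_sqrt_inner
      pairwise_def orthogonal_def)

lemma frame_inner:
  fixes u :: "'n \<Rightarrow> real^'n"
  assumes "orthonormal_frame u"
  shows "x \<bullet> y = (\<Sum>i\<in>UNIV. (u i \<bullet> x) * (u i \<bullet> y))"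
proof -
  define U where "U = (\<chi> i. u i)"
  have "transpose U ** U = mat 1"
    using orthonormal_frame_matrix[OF assms] by (simp add: U_def orthogonal_matrix_def)
  then have "x \<bullet> y = x \<bullet> (transpose U *v (U *v y))" by (simp add: matrix_vector_mul_assoc)
  also have "\<dots> = (U *v x) \<bullet> (U *v y)"
    by (metis dot_lmul_matrix transpose_matrix_vector transpose_transpose)
  also have "\<dots> = (\<Sum>i\<in>UNIV. (u i \<bullet> x) * (u i \<bullet> y))"
    by (simp add: U_def inner_vec_def[of "_ *v _"] matrix_vector_mul_component)
  finally show ?thesis .
qed

lemma frame_expansion:
  fixes u :: "'n \<Rightarrow> real^'n"
  assumes "orthonormal_frame u"
  shows "x = (\<Sum>i\<in>UNIV. (u i \<bullet> x) *\<^sub>R u i)"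
  by (rule vector_eq_rdot[THEN iffD1])
    (auto simp: frame_inner[OF assms, of x] inner_sum_left)

lemma frame_eqI:
  fixes u :: "'n \<Rightarrow> real^'n"
  assumes "orthonormal_frame u" "\<And>i. u i \<bullet> x = u i \<bullet> y"
  shows "x = y"
  using frame_expansion[OF assms(1), of x] frame_expansion[OF assms(1), of y] assms(2) by simp

lemma rows_conjugate_entry:
  fixes u :: "'n \<Rightarrow> real^'n"
  shows "((\<chi> i. u i) ** B ** transpose (\<chi> i. u i)) $ i $ j = u i \<bullet> (B *v u j)"
proof -
  have "((\<chi> i. u i) ** B ** transpose (\<chi> i. u i)) $ i $ j
      = (\<Sum>k\<in>UNIV. \<Sum>l\<in>UNIV. u i $ l * B $ l $ k * u j $ k)"
    by (simp add: matrix_matrix_mult_def transpose_def sum_distrib_right)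
  also have "\<dots> = u i \<bullet> (B *v u j)"
    by (subst sum.swap) (simp add: inner_vec_def matrix_vector_mult_def sum_distrib_left mult_ac)
  finally show ?thesis .
qed

lemma frame_trace:
  fixes u :: "'n \<Rightarrow> real^'n"
  assumes "orthonormal_frame u"
  shows "trace B = (\<Sum>i\<in>UNIV. u i \<bullet> (B *v u i))"
proof -
  define U where "U = (\<chi> i. u i)"
  have "transpose U ** U = mat 1"
    using orthonormal_frame_matrix[OF assms] by (simp add: U_def orthogonal_matrix_def)
  then have "trace B = trace (U ** B ** transpose U)"
    by (metis trace_mul_sym matrix_mul_assoc matrix_mul_lid)
  also have "\<dots> = (\<Sum>i\<in>UNIV. u i \<bullet> (B *v u i))"
    by (simp add: trace_def U_def rows_conjugate_entry)
  finally show ?thesis .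
qed

definition diag_in_frame :: "('n \<Rightarrow> real^'n) \<Rightarrow> ('n \<Rightarrow> real) \<Rightarrow> real^'n^'n" where
  "diag_in_frame u q = matrix (\<lambda>x. \<Sum>i\<in>UNIV. (q i * (u i \<bullet> x)) *\<^sub>R u i)"

lemma diag_in_frame_apply: "diag_in_frame u q *v x = (\<Sum>i\<in>UNIV. (q i * (u i \<bullet> x)) *\<^sub>R u i)"
proof -
  have "linear (\<lambda>x. \<Sum>i\<in>UNIV. (q i * (u i \<bullet> x)) *\<^sub>R u i)"
    by (auto intro!: linearI simp: inner_add_right algebra_simps sum.distrib scaleR_sum_right)
  then show ?thesis by (simp add: diag_in_frame_def matrix_works)
qed

lemma frame_inner_diag_in_frame:
  assumes "orthonormal_frame u"
  shows "u j \<bullet> (diag_in_frame u q *v x) = q j * (u j \<bullet> x)"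
  using assms by (simp add: diag_in_frame_apply inner_sum_right orthonormal_frame_def if_distrib[of "(*) _"] cong: if_cong)

lemma inner_diag_in_frame:
  "y \<bullet> (diag_in_frame u q *v x) = (\<Sum>i\<in>UNIV. q i * (u i \<bullet> x) * (u i \<bullet> y))"
  by (simp add: diag_in_frame_apply inner_sum_right inner_commute)

lemma inner_vector_matrix_mult:
  fixes A :: "real^'m^'n"
  shows "x \<bullet> (y v* A) = (A *v x) \<bullet> y"
  by (metis dot_lmul_matrix inner_commute)

lemma matrix_eq_inner:
  fixes A B :: "real^'m^'n"
  assumes "\<And>x y. y \<bullet> (A *v x) = y \<bullet> (B *v x)"
  shows "A = B"
  using assms by (metis matrix_eq vector_eq_ldot)

lemma transpose_diag_in_frame [simp]: "transpose (diag_in_frame u q) = diag_in_frame u q"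
  by (rule matrix_eq_inner) (simp add: inner_vector_matrix_mult inner_commute[of "_ *v _"] inner_diag_in_frame mult_ac)

lemma trace_diag_in_frame:
  assumes "orthonormal_frame u"
  shows "trace (diag_in_frame u q) = sum q UNIV"
  using assms by (simp add: frame_trace[OF assms] frame_inner_diag_in_frame) (simp add: orthonormal_frame_def)

lemma one_minus_diag_in_frame:
  assumes "orthonormal_frame u"
  shows "mat 1 - diag_in_frame u q = diag_in_frame u (\<lambda>i. 1 - q i)"
proof (rule matrix_eq_inner)
  fix x y
  show "y \<bullet> ((mat 1 - diag_in_frame u q) *v x) = y \<bullet> (diag_in_frame u (\<lambda>i. 1 - q i) *v x)"
    by (simp add: matrix_vector_mult_diff_rdistrib inner_diff_right inner_diag_in_frame
        frame_inner[OF assms, of y x] algebra_simps sum_subtractf)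
qed

section \<open>The eigenvalues as roots of the characteristic polynomial\<close>

text \<open>The identity is proved pointwise: evaluation at a real number commutes with the determinant, which reduces
the claim to conjugation of a real matrix by an orthogonal one.\<close>

lemma charpoly_frame:
  fixes A :: "real^'n^'n"
  assumes u: "orthonormal_frame u" and A: "\<And>i. A *v u i = d i *\<^sub>R u i"
  shows "charpoly A = (\<Prod>i\<in>UNIV. [:- d i, 1:])"
proof -
  define U where "U = (\<chi> i. u i)"
  have U: "U ** transpose U = mat 1"
    using orthonormal_frame_matrix[OF u] by (simp add: U_def orthogonal_matrix_def)
  have "poly (charpoly A) x = poly (\<Prod>i\<in>UNIV. [:- d i, 1:]) x" for x
  proof -
    define B where "B = mat x - A"
    have "poly (charpoly A) x = det B"
      by (auto simp: charpoly_def det_def poly_sum poly_prod B_def mat_def sign_def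
          intro!: sum.cong prod.cong)
    also have "\<dots> = det (U ** B ** transpose U)"
    proof -
      have "det U * det (transpose U) = 1" by (metis U det_mul det_I)
      then show ?thesis by (simp add: det_mul)
    qed
    also have "U ** B ** transpose U = (\<chi> i j. if i = j then x - d i else 0)"
    proof -
      have "(U ** B ** transpose U) $ i $ j = u i \<bullet> (B *v u j)" for i j
        by (simp add: U_def rows_conjugate_entry)
      moreover have "B *v u j = (x - d j) *\<^sub>R u j" for j
        unfolding B_def matrix_vector_mult_diff_rdistrib A
        by (simp add: mat_def matrix_vector_mult_def vec_eq_iff if_distrib[of "\<lambda>a. a * _"] algebra_simps
              if_distrib[of "\<lambda>a. _ * a"] cong: if_cong)
      ultimately show ?thesis using u by (simp add: vec_eq_iff orthonormal_frame_def)
    qed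
    also have "det \<dots> = (\<Prod>i\<in>UNIV. x - d i)" by (subst det_diagonal) simp_all
    finally show ?thesis by (simp add: poly_prod)
  qed
  then show ?thesis using poly_eq_poly_eq_iff by blast
qed

lemma mset_singular_values:
  fixes X :: "real^'m^'n"
  assumes u: "orthonormal_frame u" and A: "\<And>i. (X ** transpose X) *v u i = d i *\<^sub>R u i"
  shows "mset (singular_values X) = image_mset (\<lambda>i. sqrt (d i)) (mset_set UNIV)"
proof -
  have "proots (charpoly (X ** transpose X)) = image_mset d (mset_set UNIV)"
    unfolding charpoly_frame[OF u A] by (subst proots_prod) (auto simp: sum_unfold_sum_mset)
  then show ?thesis by (simp add: singular_values_def image_mset.compositionality o_def)
qed

section \<open>A variational formula for the r-norm\<close>

lemma inner_gram:
  fixes X :: "real^'m^'n"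
  shows "x \<bullet> ((X ** transpose X) *v y) = (x v* X) \<bullet> (y v* X)"
  by (simp add: dot_lmul_matrix flip: matrix_vector_mul_assoc)

lemma transpose_gram: "transpose (X ** transpose X) = X ** transpose X" for X :: "real^'m^'n"
  by (simp add: matrix_transpose_mul)

lemma gram_eigenvalue_nonneg:
  fixes X :: "real^'m^'n"
  assumes u: "orthonormal_frame u" and A: "\<And>i. (X ** transpose X) *v u i = d i *\<^sub>R u i"
  shows "0 \<le> d i"
proof -
  have "d i = u i \<bullet> ((X ** transpose X) *v u i)" using u by (simp add: A orthonormal_frame_def)
  then show ?thesis by (simp add: inner_gram)
qed

text \<open>For every \<open>t\<close> the weighted sum that defines the squared r-norm equals \<open>r t\<close> plus the same weighted sum of
\<open>d\<^sub>i - t\<close>, because the weights add up to \<open>r\<close>. Since the weights lie in \<open>[0, 1]\<close>, replacing each term by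
its positive part with weight one can only increase it. The bound is an equality when \<open>t\<close> is the eigenvalue with index
\<open>\<lceil>r\<rceil>\<close>, which separates the eigenvalues of weight one from those of weight zero.\<close>

lemma r_norm_sq_variational:
  fixes X :: "real^'m^'n"
  assumes u: "orthonormal_frame u" and A: "\<And>i. (X ** transpose X) *v u i = d i *\<^sub>R u i"
    and r: "1 \<le> r" "r \<le> real CARD('n)"
  shows "(r_norm r X)\<^sup>2 \<le> r * t + (\<Sum>i\<in>UNIV. max 0 (d i - t))" (is ?le)
    and "\<exists>t. (r_norm r X)\<^sup>2 = r * t + (\<Sum>i\<in>UNIV. max 0 (d i - t))" (is ?ex)
    and "0 \<le> r_norm r X"
proof -
  define s where "s = singular_values X"
  define e where "e j = (s ! j)\<^sup>2" for j
  define n where "n = CARD('n)"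
  define k where "k = nat \<lfloor>r\<rfloor>"
  define c where "c = nat \<lceil>r\<rceil> - 1"
  define \<phi> where "\<phi> = r - real k"
  have ms: "mset s = image_mset (\<lambda>i. sqrt (d i)) (mset_set UNIV)"
    unfolding s_def by (rule mset_singular_values[OF u A])
  have len: "length s = n" using arg_cong[OF ms, of size] by (simp add: n_def)
  have nonneg: "0 \<le> s ! j" if "j < n" for j
  proof -
    have "s ! j \<in># mset s" using that len by simp
    then show ?thesis unfolding ms by (auto simp: gram_eigenvalue_nonneg[OF u A])
  qed
  have "sorted (rev s)" by (simp add: s_def singular_values_def)
  then have anti: "e j \<le> e i" if "i \<le> j" "j < n" for i j
    using that len nonneg[of j] sorted_rev_nth_mono[of s i j] by (auto simp: e_def intro: power_mono)
  have sum_e: "(\<Sum>j<n. f (e j)) = (\<Sum>i\<in>UNIV. f (d i))" for f :: "real \<Rightarrow> real"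
  proof -
    have "(\<Sum>j<n. f (e j)) = sum_list (map (\<lambda>x. f (x\<^sup>2)) s)"
      by (simp add: sum_list_sum_nth e_def len atLeast0LessThan)
    also have "\<dots> = sum_mset (image_mset (\<lambda>x. f (x\<^sup>2)) (mset s))"
      by (simp flip: sum_mset_sum_list)
    also have "\<dots> = (\<Sum>i\<in>UNIV. f (d i))"
      by (simp add: ms image_mset.compositionality o_def gram_eigenvalue_nonneg[OF u A]
          sum_unfold_sum_mset)
    finally show ?thesis .
  qed
  have k: "real k = of_int \<lfloor>r\<rfloor>" "1 \<le> k"
  proof -
    have "1 \<le> \<lfloor>r\<rfloor>" using r by simp
    then show "real k = of_int \<lfloor>r\<rfloor>" "1 \<le> k" unfolding k_def by linarith+
  qed
  have \<phi>: "0 \<le> \<phi>" "\<phi> \<le> 1" unfolding \<phi>_def k by linarith+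
  have kn: "k \<le> n" using r k unfolding n_def by linarith
  \<comment> \<open>The position, counted from zero, of the entry of fractional weight; if \<open>r\<close> is an integer, it coincides
    with the last entry of weight one and its extra weight is zero.\<close>
  have c: "(\<phi> = 0 \<and> c = k - 1) \<or> (c = k \<and> k < n)"
  proof (cases "\<phi> = 0")
    case True
    then have "r = of_int \<lfloor>r\<rfloor>" using k by (simp add: \<phi>_def)
    then have "\<lceil>r\<rceil> = \<lfloor>r\<rfloor>" by (metis ceiling_of_int)
    then show ?thesis using True by (simp add: c_def k_def)
  next
    case False
    then have "r \<noteq> of_int \<lfloor>r\<rfloor>" using k by (simp add: \<phi>_def)
    then have "\<lceil>r\<rceil> = \<lfloor>r\<rfloor> + 1" by (metis ceiling_altdef)
    moreover have "0 \<le> \<lfloor>r\<rfloor>" using r by simp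
    ultimately have "c = k" by (simp add: c_def k_def nat_add_distrib)
    moreover have "k < n" using False \<phi> kn r unfolding \<phi>_def n_def by linarith
    ultimately show ?thesis by simp
  qed
  have cn: "c < n" using c kn k by auto
  have sq: "(r_norm r X)\<^sup>2 = (\<Sum>j<k. e j) + \<phi> * e c" and nonneg_norm: "0 \<le> r_norm r X"
  proof -
    have "(\<Sum>i = 1..k. (sigma i X)\<^sup>2) = (\<Sum>j<k. e j)"
      by (simp add: sum.atLeast1_atMost_eq sigma_def e_def s_def)
    then have "r_norm r X = sqrt ((\<Sum>j<k. e j) + \<phi> * e c)"
      by (simp add: r_norm_def sigma_def e_def s_def c_def k(1) \<phi>_def flip: k_def)
    moreover have "0 \<le> (\<Sum>j<k. e j) + \<phi> * e c"
      using \<phi> by (intro add_nonneg_nonneg sum_nonneg) (auto simp: e_def)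
    ultimately show "(r_norm r X)\<^sup>2 = (\<Sum>j<k. e j) + \<phi> * e c" "0 \<le> r_norm r X" by simp_all
  qed
  show "0 \<le> r_norm r X" by (fact nonneg_norm)
  have shift: "(r_norm r X)\<^sup>2 = r * t + ((\<Sum>j<k. e j - t) + \<phi> * (e c - t))" for t
    by (simp add: sq \<phi>_def sum_subtractf algebra_simps)
  show ?le
  proof -
    have "(\<Sum>j<k. e j - t) + \<phi> * (e c - t) \<le> (\<Sum>j<k. max 0 (e j - t)) + \<phi> * max 0 (e c - t)"
      using \<phi> by (intro add_mono sum_mono mult_left_mono) auto
    also have "\<dots> \<le> (\<Sum>j<n. max 0 (e j - t))"
      using c
    proof
      assume "\<phi> = 0 \<and> c = k - 1"
      then show ?thesis using kn by (auto intro!: sum_mono2)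
    next
      assume c: "c = k \<and> k < n"
      have "\<phi> * max 0 (e c - t) \<le> max 0 (e c - t)"
        using \<phi> by (intro mult_left_le_one_le) auto
      then have "(\<Sum>j<k. max 0 (e j - t)) + \<phi> * max 0 (e c - t) \<le> (\<Sum>j<Suc k. max 0 (e j - t))"
        using c by simp
      also have "\<dots> \<le> (\<Sum>j<n. max 0 (e j - t))" using c by (intro sum_mono2) auto
      finally show ?thesis .
    qed
    finally show ?thesis using sum_e[of "\<lambda>x. max 0 (x - t)"] shift[of t] by simp
  qed
  show ?ex
  proof
    have "(\<Sum>j<k. e j - e c) = (\<Sum>j<k. max 0 (e j - e c))"
      using c cn anti[of _ c] by (intro sum.cong) (auto simp: max_def)
    also have "\<dots> = (\<Sum>j<n. max 0 (e j - e c))"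
    proof (intro sum.mono_neutral_left ballI)
      fix j assume "j \<in> {..<n} - {..<k}"
      then have "e j \<le> e c" using c by (intro anti) auto
      then show "max 0 (e j - e c) = 0" by simp
    qed (use kn in auto)
    finally show "(r_norm r X)\<^sup>2 = r * e c + (\<Sum>i\<in>UNIV. max 0 (d i - e c))"
      using sum_e[of "\<lambda>x. max 0 (x - e c)"] shift[of "e c"] by simp
  qed
qed

lemma trace_gram_frame:
  fixes X :: "real^'m^'n"
  assumes u: "orthonormal_frame u" and A: "\<And>i. (X ** transpose X) *v u i = d i *\<^sub>R u i"
  shows "trace (transpose X ** Q ** X) = (\<Sum>i\<in>UNIV. d i * (u i \<bullet> (Q *v u i)))"
proof -
  have "trace (transpose X ** Q ** X) = trace (Q ** (X ** transpose X))"
    by (metis matrix_mul_assoc trace_mul_sym)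
  also have "\<dots> = (\<Sum>i\<in>UNIV. u i \<bullet> (Q *v ((X ** transpose X) *v u i)))"
    unfolding frame_trace[OF u] matrix_vector_mul_assoc ..
  finally show ?thesis by (simp only: A matrix_vector_mult_scaleR inner_scaleR_right)
qed

text \<open>The inequality half of Ky Fan's maximum principle, extended to real \<open>r\<close>: in an eigenframe of
\<open>X X\<^sup>T\<close> the trace is a weighted sum of eigenvalues with weights in \<open>[0, 1]\<close> that add up to \<open>r\<close>, and the
variational formula bounds every such sum.\<close>

lemma trace_le_r_norm_sq:
  fixes X :: "real^'m^'n"
  assumes P: "psd P" and Q: "psd (mat 1 - P)" and tr: "trace P = real CARD('n) - r"
    and r: "1 \<le> r" "r \<le> real CARD('n)"
  shows "trace (transpose X ** (mat 1 - P) ** X) \<le> (r_norm r X)\<^sup>2"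
proof -
  obtain u d where u: "orthonormal_frame u" and A: "\<And>i. (X ** transpose X) *v u i = d i *\<^sub>R u i"
    using symmetric_matrix_eigenframe[OF transpose_gram[of X]] by blast
  define q where "q i = u i \<bullet> ((mat 1 - P) *v u i)" for i
  have q0: "0 \<le> q i" for i using Q by (simp add: q_def psd_def)
  have q1: "q i \<le> 1" for i
    using P u by (simp add: q_def psd_def matrix_vector_mult_diff_rdistrib inner_diff_right orthonormal_frame_def)
  have "sum q UNIV = trace (mat 1 - P)" by (simp add: q_def frame_trace[OF u])
  then have sq: "sum q UNIV = r" by (simp add: tr trace_sub trace_I)
  obtain t where t: "(r_norm r X)\<^sup>2 = r * t + (\<Sum>i\<in>UNIV. max 0 (d i - t))"
    using r_norm_sq_variational(2)[OF u A r] by blast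
  have "trace (transpose X ** (mat 1 - P) ** X) = (\<Sum>i\<in>UNIV. d i * q i)"
    by (simp add: trace_gram_frame[OF u A] q_def)
  also have "\<dots> = r * t + (\<Sum>i\<in>UNIV. q i * (d i - t))"
    by (simp add: sq[symmetric] sum_distrib_right flip: sum.distrib) (simp add: algebra_simps)
  also have "\<dots> \<le> r * t + (\<Sum>i\<in>UNIV. max 0 (d i - t))"
  proof -
    have "q i * (d i - t) \<le> max 0 (d i - t)" for i
    proof (cases "0 \<le> d i - t")
      case True
      then show ?thesis using q0[of i] q1[of i] mult_left_le_one_le[of "d i - t" "q i"] by simp
    next
      case False
      then show ?thesis using q0[of i] mult_nonneg_nonpos[of "q i" "d i - t"] by simp
    qed
    then show ?thesis by (simp add: sum_mono)
  qed
  finally show ?thesis by (simp add: t)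
qed

section \<open>Feasible points bound the dual norm\<close>

lemma frob_inner_columns: "frob_inner X Y = (\<Sum>j\<in>UNIV. column j X \<bullet> column j Y)"
  by (simp add: frob_inner_def trace_def matrix_matrix_mult_def transpose_def column_def inner_vec_def)

lemma trace_conjugate_columns:
  "trace (transpose X ** Q ** X) = (\<Sum>j\<in>UNIV. column j X \<bullet> (Q *v column j X))"
  for X :: "real^'m^'n"
proof -
  have "column j (Q ** X) = Q *v column j X" for j
    by (simp add: column_def matrix_vector_mult_def matrix_matrix_mult_def)
  then show ?thesis using frob_inner_columns[of X "Q ** X"]
    by (simp add: frob_inner_def matrix_mul_assoc)
qed

lemma sum_UNIV_Plus: "(\<Sum>i\<in>(UNIV::('a::finite + 'b::finite) set). f i)
  = (\<Sum>i\<in>UNIV. f (Inl i)) + (\<Sum>i\<in>UNIV. f (Inr i))"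
  using sum.Plus[of "UNIV::'a set" "UNIV :: 'b set" f] by (simp add: o_def)

lemma block_matrix_quadratic_form:
  fixes A :: "real^'n^'n" and B :: "real^'m^'n"
  shows "z \<bullet> (block_matrix A B (transpose B) D *v z) =
    (let x = \<chi> i. z $ Inl i; y = \<chi> j. z $ Inr j in x \<bullet> (A *v x) + 2 * (x \<bullet> (B *v y)) + y \<bullet> (D *v y))"
proof -
  define x where "x = (\<chi> i. z $ Inl i)"
  define y where "y = (\<chi> j. z $ Inr j)"
  have "z \<bullet> (block_matrix A B (transpose B) D *v z) =
    x \<bullet> (A *v x) + x \<bullet> (B *v y) + (y \<bullet> (transpose B *v x) + y \<bullet> (D *v y))"
    by (simp add: inner_vec_def matrix_vector_mult_def sum_UNIV_Plus block_matrix_def x_def y_def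
        sum.distrib distrib_left del: transpose_matrix_vector)
  also have "y \<bullet> (transpose B *v x) = x \<bullet> (B *v y)"
    by (simp add: inner_vector_matrix_mult inner_commute)
  finally show ?thesis by (simp add: Let_def x_def y_def)
qed

lemma psd_block_matrix_iff:
  fixes A :: "real^'n^'n" and B :: "real^'m^'n"
  shows "psd (block_matrix A B (transpose B) D) \<longleftrightarrow> transpose A = A \<and> transpose D = D \<and>
    (\<forall>x y. 0 \<le> x \<bullet> (A *v x) + 2 * (x \<bullet> (B *v y)) + y \<bullet> (D *v y))"
proof -
  have "transpose (block_matrix A B (transpose B) D) = block_matrix A B (transpose B) D \<longleftrightarrow>
    transpose A = A \<and> transpose D = D"
    by (auto simp: vec_eq_iff block_matrix_def transpose_def split_sum_all)
  moreover have "(\<forall>z. 0 \<le> z \<bullet> (block_matrix A B (transpose B) D *v z)) \<longleftrightarrow>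
    (\<forall>x y. 0 \<le> x \<bullet> (A *v x) + 2 * (x \<bullet> (B *v y)) + y \<bullet> (D *v y))" (is "?l \<longleftrightarrow> ?r")
  proof
    assume l: ?l
    show ?r
    proof (intro allI)
      fix x y
      show "0 \<le> x \<bullet> (A *v x) + 2 * (x \<bullet> (B *v y)) + y \<bullet> (D *v y)"
        using l[rule_format, of "\<chi> i. case i of Inl a \<Rightarrow> x $ a | Inr b \<Rightarrow> y $ b"]
        by (simp add: block_matrix_quadratic_form Let_def)
    qed
  qed (simp add: block_matrix_quadratic_form Let_def)
  ultimately show ?thesis by (auto simp: psd_def)
qed

text \<open>A Cauchy-Schwarz inequality. Evaluating the block matrix on each column of \<open>X\<close>, paired with \<open>t\<close> times the
unit vector of that column, and adding up gives a nonnegative quadratic polynomial in \<open>t\<close>.\<close>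

lemma frob_inner_sq_le_trace:
  fixes M :: "real^'m^'n"
  assumes psd: "psd (block_matrix A M (transpose M) W)"
    and X: "trace (transpose X ** A ** X) \<le> 1"
  shows "(frob_inner M X)\<^sup>2 \<le> trace W"
proof -
  have *: "0 \<le> trace (transpose X ** A ** X) + 2 * t * frob_inner M X + t\<^sup>2 * trace W" for X t
  proof -
    have "0 \<le> (\<Sum>j\<in>UNIV. column j X \<bullet> (A *v column j X) + 2 * (column j X \<bullet> (M *v (t *\<^sub>R axis j 1)))
        + (t *\<^sub>R axis j 1) \<bullet> (W *v (t *\<^sub>R axis j 1)))"
      using psd unfolding psd_block_matrix_iff by (intro sum_nonneg) blast
    also have "\<dots> = (\<Sum>j\<in>UNIV. column j X \<bullet> (A *v column j X) + 2 * t * (column j M \<bullet> column j X)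
        + t\<^sup>2 * W $ j $ j)"
      by (simp add: matrix_vector_mult_scaleR matrix_vector_mult_basis inner_axis' column_def[of _ W]
          power2_eq_square mult.assoc inner_commute[of "column _ M"])
    also have "\<dots> = trace (transpose X ** A ** X) + 2 * t * frob_inner M X + t\<^sup>2 * trace W"
      by (simp add: sum.distrib trace_conjugate_columns frob_inner_columns sum_distrib_left trace_def[of W])
    finally show ?thesis .
  qed
  show ?thesis
  proof (cases "frob_inner M X = 0")
    case True
    have "trace (transpose 0 ** A ** (0 :: real^'m^'n)) = 0" "frob_inner M 0 = 0"
      by (simp_all add: trace_def frob_inner_columns column_def inner_vec_def)
    then show ?thesis using *[of 0 1] True by simp
  next
    case False
    \<comment> \<open>This \<open>t\<close> need not minimize the polynomial, but it avoids dividing by \<open>trace W\<close>, which might be zero.\<close>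
    then have "0 \<le> trace (transpose X ** A ** X) - 2 + trace W / (frob_inner M X)\<^sup>2"
      using *[of X "- 1 / frob_inner M X"] by (simp add: power_divide)
    then have "1 \<le> trace W / (frob_inner M X)\<^sup>2" using X by linarith
    then show ?thesis using False by (simp add: le_divide_eq_1)
  qed
qed

section \<open>Water-filling\<close>

text \<open>If at most \<open>r\<close> of the \<open>s\<^sub>i\<close> are positive, the level \<open>l = 0\<close> works and the remaining weight is spread over the
vanishing entries. Otherwise \<open>l\<close> comes from the intermediate value theorem: the sum of
\<open>s\<^sub>i / max l s\<^sub>i\<close> is continuous for \<open>l > 0\<close>, it counts the positive entries when \<open>l\<close> is the smallest
of them, and it is at most \<open>r\<close> for large \<open>l\<close>.\<close>

lemma water_filling:
  fixes s :: "'n::finite \<Rightarrow> real"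
  assumes s: "\<And>i. 0 \<le> s i" and r: "0 < r" "r \<le> real CARD('n)"
  shows "\<exists>l q. 0 \<le> l \<and> sum q UNIV = r \<and> (\<forall>i. 0 \<le> q i \<and> q i \<le> 1 \<and>
    (l < s i \<longrightarrow> q i = 1) \<and> (s i \<le> l \<longrightarrow> q i * l = s i))"
proof -
  define k where "k = card {i. 0 < s i}"
  have kn: "k + card {i. \<not> 0 < s i} = CARD('n)"
    unfolding k_def by (subst card_Un_disjoint[symmetric]) (auto intro: arg_cong[of _ _ card])
  show ?thesis
  proof (cases "real k \<le> r")
    case True
    define z where "z = (r - real k) / (real CARD('n) - real k)"
    have kn': "real k \<le> real CARD('n)" using kn by linarith
    have z: "0 \<le> z" "z \<le> 1" using True r kn' by (auto simp: z_def divide_le_eq)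
    define q where "q i = (if 0 < s i then 1 else z)" for i
    have "sum q UNIV = real k + (real CARD('n) - real k) * z"
    proof -
      have "sum q UNIV = real k + real (card {i. \<not> 0 < s i}) * z"
        unfolding q_def k_def by (subst sum.If_cases) (auto simp: Compl_eq)
      moreover have "real (card {i. \<not> 0 < s i}) = real CARD('n) - real k" using kn by linarith
      ultimately show ?thesis by simp
    qed
    also have "\<dots> = r" using True r by (auto simp: z_def)
    finally have "sum q UNIV = r" .
    then show ?thesis using z s
      by (intro exI[of _ 0] exI[of _ q]) (auto simp: q_def not_less intro: order.antisym)
  next
    case False
    define F where "F x = (\<Sum>i\<in>UNIV. s i / max x (s i))" for x
    have "{i. 0 < s i} \<noteq> {}"
    proof
      assume "{i. 0 < s i} = {}"
      then show False using False r by (simp only: k_def card.empty)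
    qed
    define \<epsilon> where "\<epsilon> = Min (s ` {i. 0 < s i})"
    have eps: "0 < \<epsilon>" unfolding \<epsilon>_def using \<open>{i. 0 < s i} \<noteq> {}\<close> by (subst Min_gr_iff) auto
    have eps_le: "\<epsilon> \<le> s i" if "0 < s i" for i unfolding \<epsilon>_def using that by (intro Min_le) auto
    have "F \<epsilon> = (\<Sum>i\<in>UNIV. if 0 < s i then 1 else 0)"
      unfolding F_def using s eps_le by (intro sum.cong) (auto simp: max_def not_less intro: order.antisym)
    then have F1: "F \<epsilon> = real k" by (simp add: k_def flip: sum.inter_filter)
    define R where "R = max \<epsilon> (sum s UNIV / r)"
    have R: "0 < R" "sum s UNIV / r \<le> R" "\<epsilon> \<le> R" using eps by (auto simp: R_def)
    have "F R \<le> (\<Sum>i\<in>UNIV. s i / R)"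
      unfolding F_def using s R by (intro sum_mono divide_left_mono) (auto simp: max_def)
    also have "\<dots> \<le> r" using R r by (simp add: field_simps flip: sum_divide_distrib)
    finally have F2: "F R \<le> r" .
    have "continuous_on {\<epsilon>..R} F"
      unfolding F_def using eps by (intro continuous_intros) auto
    then obtain l where l: "\<epsilon> \<le> l" "F l = r"
      using IVT2'[of F R r \<epsilon>] F1 F2 R False by auto
    then show ?thesis using s eps unfolding F_def
      by (intro exI[of _ l] exI[of _ "\<lambda>i. s i / max l (s i)"]) (auto simp: max_def divide_le_eq)
  qed
qed

section \<open>The dual norm as the value of a semidefinite program\<close>

text \<open>Ensures that the supremum that defines the dual norm is taken over a nonempty set.\<close>

lemma r_norm_zero_le:
  assumes r: "1 \<le> r" "r \<le> real CARD('n)"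
  shows "r_norm r (0 :: real^'m^'n) \<le> 1"
proof -
  obtain u d where u: "orthonormal_frame u"
    and "\<And>i. (mat 1 :: real^'n^'n) *v u i = d i *\<^sub>R u i"
    using symmetric_matrix_eigenframe[of "mat 1 :: real^'n^'n"] by (auto simp: transpose_mat)
  have "((0 :: real^'m^'n) ** transpose 0) *v u i = 0 *\<^sub>R u i" for i
    by (simp flip: matrix_vector_mul_assoc)
  from r_norm_sq_variational(1)[OF u this r, of 0] show ?thesis
    by simp
qed

text \<open>The boundedness is part of the result because the supremum of an unbounded set of reals is unspecified;
the lower bound on the dual norm needs it too.\<close>

lemma feasible_bounds:
  fixes M :: "real^'m^'n"
  assumes feas: "sdp_feasible r (M, P, W)" and r: "1 \<le> r" "r \<le> real CARD('n)"
  shows "bdd_above (frob_inner M ` {X. r_norm r X \<le> 1})"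
    and "(r_dual_norm r M)\<^sup>2 \<le> trace W"
proof -
  have blk: "psd (block_matrix (mat 1 - P) M (transpose M) W)"
    and P: "psd P" "trace P = real CARD('n) - r"
    using feas by (auto simp: sdp_feasible_def)
  have Q: "psd (mat 1 - P)"
    unfolding psd_def
  proof (intro conjI allI)
    show "transpose (mat 1 - P) = mat 1 - P" using blk by (simp add: psd_block_matrix_iff)
    fix x
    have "0 \<le> x \<bullet> ((mat 1 - P) *v x) + 2 * (x \<bullet> (M *v 0)) + 0 \<bullet> (W *v 0)"
      using blk unfolding psd_block_matrix_iff by blast
    then show "0 \<le> x \<bullet> ((mat 1 - P) *v x)" by simp
  qed
  have sq: "(frob_inner M X)\<^sup>2 \<le> trace W" if "r_norm r X \<le> 1" for X
  proof (rule frob_inner_sq_le_trace[OF blk])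
    obtain u d where "orthonormal_frame u" "\<And>i. (X ** transpose X) *v u i = d i *\<^sub>R u i"
      using symmetric_matrix_eigenframe[OF transpose_gram[of X]] by blast
    from r_norm_sq_variational(3)[OF this r] that have "(r_norm r X)\<^sup>2 \<le> 1"
      by (intro power_le_one)
    with trace_le_r_norm_sq[OF P(1) Q P(2) r, of X]
    show "trace (transpose X ** (mat 1 - P) ** X) \<le> 1" by linarith
  qed
  then have le: "frob_inner M X \<le> sqrt (trace W)" if "r_norm r X \<le> 1" for X
    using that by (auto intro: real_le_rsqrt)
  then show bdd: "bdd_above (frob_inner M ` {X. r_norm r X \<le> 1})" by (intro bdd_aboveI2) auto
  have zero: "(0 :: real^'m^'n) \<in> {X. r_norm r X \<le> 1}" using r_norm_zero_le[OF r] by simp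
  have "r_dual_norm r M \<le> sqrt (trace W)"
    unfolding r_dual_norm_def using zero le by (intro cSUP_least) auto
  moreover have "frob_inner M 0 \<le> r_dual_norm r M"
    unfolding r_dual_norm_def using zero bdd by (rule cSUP_upper)
  moreover have "frob_inner M 0 = 0"
    by (simp add: frob_inner_columns column_def inner_vec_def)
  moreover have "0 \<le> trace W" using sq[of 0] zero by (smt (verit) mem_Collect_eq zero_le_power2)
  ultimately show "(r_dual_norm r M)\<^sup>2 \<le> trace W"
    using power_mono[of "r_dual_norm r M" "sqrt (trace W)" 2] by simp
qed

text \<open>The choice of \<open>q\<close> makes all \<open>s\<^sub>i / q\<^sub>i\<close> equal to \<open>max l s\<^sub>i\<close> wherever \<open>s\<^sub>i > 0\<close>. These are the
singular values of \<open>Q\<^sup>+ M\<close>, and the choice \<open>t = l\<^sup>2\<close> in the variational formula shows that the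
square of the r-norm of \<open>Q\<^sup>+ M\<close> is at most \<open>T = trace W = \<langle>M, Q\<^sup>+ M\<rangle>\<close>.\<close>

lemma feasible_attaining_dual_norm:
  fixes M :: "real^'m^'n"
  assumes r: "1 \<le> r" "r \<le> real CARD('n)"
  obtains P W where "sdp_feasible r (M, P, W)" "trace W \<le> (r_dual_norm r M)\<^sup>2"
proof -
  obtain u e where u: "orthonormal_frame u" and A: "\<And>i. (M ** transpose M) *v u i = e i *\<^sub>R u i"
    using symmetric_matrix_eigenframe[OF transpose_gram[of M]] by blast
  have e: "0 \<le> e i" for i using gram_eigenvalue_nonneg[OF u A] .
  define s where "s i = sqrt (e i)" for i
  have es: "e i = (s i)\<^sup>2" and s0: "0 \<le> s i" for i using e by (simp_all add: s_def)
  have "0 < r" using r by simp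
  have "\<exists>l q. 0 \<le> l \<and> sum q UNIV = r \<and> (\<forall>i. 0 \<le> q i \<and> q i \<le> 1 \<and>
    (l < s i \<longrightarrow> q i = 1) \<and> (s i \<le> l \<longrightarrow> q i * l = s i))"
    by (rule water_filling) (fact s0 \<open>0 < r\<close> r(2))+
  then obtain l q where l: "0 \<le> l" and sumq: "sum q UNIV = r"
    and lq: "\<forall>i. 0 \<le> q i \<and> q i \<le> 1 \<and> (l < s i \<longrightarrow> q i = 1) \<and> (s i \<le> l \<longrightarrow> q i * l = s i)"
    by (elim exE conjE)
  have q: "0 \<le> q i" "q i \<le> 1" and big: "l < s i \<Longrightarrow> q i = 1" and small: "s i \<le> l \<Longrightarrow> q i * l = s i" for i
    using lq by simp_all
  \<comment> \<open>As \<open>inverse 0 = 0\<close>, these are the diagonal entries of the pseudoinverse of \<open>Q\<close>.\<close>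
  define c where "c i = inverse (q i)" for i
  define T where "T = (\<Sum>i\<in>UNIV. e i * c i)"
  define P where "P = diag_in_frame u (\<lambda>i. 1 - q i)"
  define W where "W = transpose M ** diag_in_frame u c ** M"
  have q_zero: "e i = 0" if "q i = 0" for i
    using that big[of i] small[of i] by (cases "l < s i") (auto simp: es)
  have coord_zero: "u i \<bullet> (M *v y) = 0" if "q i = 0" for i y
  proof -
    have "(u i v* M) \<bullet> (u i v* M) = u i \<bullet> ((M ** transpose M) *v u i)" by (simp add: inner_gram)
    also have "\<dots> = 0" by (simp only: A q_zero[OF that]) simp
    finally show ?thesis by (simp flip: dot_lmul_matrix)
  qed
  have IP: "mat 1 - P = diag_in_frame u q" using one_minus_diag_in_frame[OF u, of "\<lambda>i. 1 - q i"] by (simp add: P_def)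
  have feas: "sdp_feasible r (M, P, W)"
  proof -
    have tW: "transpose W = W" by (simp add: W_def matrix_transpose_mul matrix_mul_assoc)
    have tP: "transpose P = P" by (simp add: P_def)
    have "psd P"
      using q by (auto simp: psd_def tP) (auto simp: P_def inner_diag_in_frame mult.assoc intro!: sum_nonneg)
    moreover have "trace P = real CARD('n) - r"
      by (simp add: P_def trace_diag_in_frame[OF u] sum_subtractf sumq)
    moreover have "psd (block_matrix (mat 1 - P) M (transpose M) W)"
      unfolding psd_block_matrix_iff
    proof (intro conjI allI)
      show "transpose (mat 1 - P) = mat 1 - P" by (simp add: IP)
      show "transpose W = W" by (fact tW)
      fix x y
      define a where "a i = u i \<bullet> x" for i
      define z where "z i = u i \<bullet> (M *v y)" for i
      have "y \<bullet> (W *v y) = (M *v y) \<bullet> (diag_in_frame u c *v (M *v y))"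
        by (simp add: W_def inner_vector_matrix_mult flip: matrix_vector_mul_assoc)
      then have "x \<bullet> ((mat 1 - P) *v x) + 2 * (x \<bullet> (M *v y)) + y \<bullet> (W *v y)
        = (\<Sum>i\<in>UNIV. q i * a i * a i + 2 * (a i * z i) + c i * z i * z i)"
        by (simp add: IP inner_diag_in_frame frame_inner[OF u, of x "M *v y"] a_def z_def sum.distrib sum_distrib_left)
      also have "\<dots> \<ge> 0"
      proof (rule sum_nonneg)
        fix i
        show "0 \<le> q i * a i * a i + 2 * (a i * z i) + c i * z i * z i"
        proof (cases "q i = 0")
          case True
          then show ?thesis using coord_zero[of i y] by (simp add: z_def)
        next
          case False
          \<comment> \<open>The Schur complement of the i-th coordinate is zero, so the form is a square.\<close>
          then have "q i * a i * a i + 2 * (a i * z i) + c i * z i * z i = q i * (a i + c i * z i)\<^sup>2"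
            by (simp add: c_def power2_eq_square field_simps)
          then show ?thesis using q by simp
        qed
      qed
      finally show "0 \<le> x \<bullet> ((mat 1 - P) *v x) + 2 * (x \<bullet> (M *v y)) + y \<bullet> (W *v y)" .
    qed
    ultimately show ?thesis using tW tP by (simp add: sdp_feasible_def)
  qed
  have trW: "trace (transpose M ** diag_in_frame u b ** M) = (\<Sum>i\<in>UNIV. e i * b i)" for b
    using u by (simp add: trace_gram_frame[OF u A] frame_inner_diag_in_frame[OF u]) (simp add: orthonormal_frame_def)
  have T: "T = r * l\<^sup>2 + (\<Sum>i\<in>UNIV. max 0 (e i - l\<^sup>2))"
  proof -
    have "e i * c i = q i * l\<^sup>2 + max 0 (e i - l\<^sup>2)" for i
    proof (cases "l < s i")
      case True
      then have "l\<^sup>2 \<le> e i" using l by (simp add: es power_mono)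
      then show ?thesis using big[OF True] by (simp add: c_def)
    next
      case False
      then have "e i \<le> l\<^sup>2" and sl: "s i = q i * l" using s0 small by (simp_all add: es power_mono)
      then show ?thesis by (cases "q i = 0") (simp_all add: c_def es sl power2_eq_square)
    qed
    then show ?thesis by (simp add: T_def sum.distrib sumq flip: sum_distrib_right)
  qed
  have "T \<le> (r_dual_norm r M)\<^sup>2"
  proof (cases "0 < T")
    case True
    define b where "b i = c i / sqrt T" for i
    define X where "X = diag_in_frame u b ** M"
    have X: "(X ** transpose X) *v u i = ((b i)\<^sup>2 * e i) *\<^sub>R u i" for i
    proof -
      have *: "diag_in_frame u b *v u i = b i *\<^sub>R u i" for i
        using u by (intro frame_eqI[OF u]) (simp add: frame_inner_diag_in_frame[OF u], simp add: orthonormal_frame_def)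
      have "(X ** transpose X) *v u i = diag_in_frame u b *v ((M ** transpose M) *v (diag_in_frame u b *v u i))"
        by (simp add: X_def matrix_transpose_mul matrix_vector_mul_assoc matrix_mul_assoc del: transpose_matrix_vector)
      also have "\<dots> = ((b i)\<^sup>2 * e i) *\<^sub>R u i"
        by (simp only: * A matrix_vector_mult_scaleR) (simp add: * power2_eq_square)
      finally show ?thesis .
    qed
    have "max 0 ((c i)\<^sup>2 * e i - l\<^sup>2) = max 0 (e i - l\<^sup>2)" for i
    proof (cases "l < s i")
      case True
      then show ?thesis using big[OF True] by (simp add: c_def)
    next
      case False
      then have "e i \<le> l\<^sup>2" and sl: "s i = q i * l" using s0 small by (simp_all add: es power_mono)
      then show ?thesis by (cases "q i = 0") (simp_all add: c_def es sl power_mult_distrib field_simps)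
    qed
    moreover have "max 0 ((b i)\<^sup>2 * e i - l\<^sup>2 / T) = max 0 ((c i)\<^sup>2 * e i - l\<^sup>2) / T" for i
      using True by (simp add: b_def power_divide max_divide_distrib_right diff_divide_distrib)
    ultimately have "r * (l\<^sup>2 / T) + (\<Sum>i\<in>UNIV. max 0 ((b i)\<^sup>2 * e i - l\<^sup>2 / T))
        = (r * l\<^sup>2 + (\<Sum>i\<in>UNIV. max 0 (e i - l\<^sup>2))) / T"
      by (simp add: add_divide_distrib sum_divide_distrib)
    also have "\<dots> = 1" unfolding T[symmetric] using True by simp
    finally have "r * (l\<^sup>2 / T) + (\<Sum>i\<in>UNIV. max 0 ((b i)\<^sup>2 * e i - l\<^sup>2 / T)) = 1" .
    then have "(r_norm r X)\<^sup>2 \<le> 1"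
      using r_norm_sq_variational(1)[OF u X r, of "l\<^sup>2 / T"] True by simp
    then have "r_norm r X \<le> 1" by (simp add: power2_le_imp_le)
    then have "frob_inner M X \<le> r_dual_norm r M"
      unfolding r_dual_norm_def by (intro cSUP_upper feasible_bounds(1)[OF feas r]) simp
    moreover have "frob_inner M X = sqrt T"
    proof -
      have "frob_inner M X = (\<Sum>i\<in>UNIV. e i * b i)"
        by (simp add: frob_inner_def X_def matrix_mul_assoc trW)
      also have "\<dots> = T / sqrt T" by (simp add: b_def T_def sum_divide_distrib)
      finally show ?thesis by (simp add: real_div_sqrt True less_imp_le)
    qed
    ultimately show ?thesis using True sqrt_le_D by auto
  next
    case False
    then show ?thesis by (smt (verit) zero_le_power2)
  qed
  then show ?thesis using that[OF feas] by (simp add: W_def trW T_def)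
qed

theorem mainTheorem5:
  fixes N :: "real^'m^'n"
    and r :: real
    and g :: "real^'m^'n \<Rightarrow> ereal"
  assumes "CARD('n) \<le> CARD('m)"
    and "1 \<le> r" and "r \<le> real CARD('n)"
    and "\<forall>M. g M \<noteq> -\<infinity>"
    and "closed (ext_epigraph g)"
    and "ext_epigraph g \<noteq> {}"
    and "convex (ext_epigraph g)"
    and "sdp_representable g"
    and "\<exists>M. real (rank M) \<le> r \<and> g M < \<infinity>"
  shows "(INF M. norm_objective N r g M) = (INF X \<in> {X. sdp_feasible r X}. sdp_objective N g X)
    \<and> (\<forall>M. is_arg_min (norm_objective N r g) (\<lambda>_. True) M \<longleftrightarrow>
            (\<exists>P W. is_arg_min (sdp_objective N g) (sdp_feasible r) (M, P, W)))"
proof -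
  note r = assms(2,3)
  have lower: "norm_objective N r g M \<le> sdp_objective N g (M, P, W)"
    if "sdp_feasible r (M, P, W)" for M P W
    using feasible_bounds(2)[OF that r]
    by (auto simp: norm_objective_def sdp_objective_def frob_inner_def intro!: add_right_mono)
  have attained: "\<exists>P W. sdp_feasible r (M, P, W) \<and> sdp_objective N g (M, P, W) \<le> norm_objective N r g M" for M
  proof -
    obtain P W where "sdp_feasible r (M, P, W)" "trace W \<le> (r_dual_norm r M)\<^sup>2"
      using feasible_attaining_dual_norm[OF r] by blast
    then show ?thesis
      by (intro exI[of _ P] exI[of _ W])
        (auto simp: norm_objective_def sdp_objective_def frob_inner_def intro!: add_right_mono)
  qed
  have "(INF M. norm_objective N r g M) = (INF X \<in> {X. sdp_feasible r X}. sdp_objective N g X)"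
  proof (rule antisym)
    show "(INF M. norm_objective N r g M) \<le> (INF X \<in> {X. sdp_feasible r X}. sdp_objective N g X)"
      using lower by (auto intro!: INF_greatest intro: INF_lower2)
    show "(INF X \<in> {X. sdp_feasible r X}. sdp_objective N g X) \<le> (INF M. norm_objective N r g M)"
      using attained by (intro INF_greatest) (meson INF_lower2 mem_Collect_eq)
  qed
  moreover have "is_arg_min (norm_objective N r g) (\<lambda>_. True) M \<longleftrightarrow>
            (\<exists>P W. is_arg_min (sdp_objective N g) (sdp_feasible r) (M, P, W))" for M
  proof
    assume M: "is_arg_min (norm_objective N r g) (\<lambda>_. True) M"
    obtain P W where PW: "sdp_feasible r (M, P, W)"
      "sdp_objective N g (M, P, W) \<le> norm_objective N r g M" using attained by blast
    have "sdp_objective N g (M, P, W) \<le> sdp_objective N g (M', P', W')"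
      if "sdp_feasible r (M', P', W')" for M' P' W'
      using PW(2) lower[OF that] M by (auto simp: is_arg_min_linorder intro: order_trans)
    with PW(1) show "\<exists>P W. is_arg_min (sdp_objective N g) (sdp_feasible r) (M, P, W)"
      by (auto simp: is_arg_min_linorder)
  next
    assume "\<exists>P W. is_arg_min (sdp_objective N g) (sdp_feasible r) (M, P, W)"
    then obtain P W where PW: "sdp_feasible r (M, P, W)"
      and min: "\<And>X. sdp_feasible r X \<Longrightarrow> sdp_objective N g (M, P, W) \<le> sdp_objective N g X"
      by (auto simp: is_arg_min_linorder)
    have "norm_objective N r g M \<le> norm_objective N r g M'" for M'
      using lower[OF PW] attained[of M'] min by (meson order_trans)
    then show "is_arg_min (norm_objective N r g) (\<lambda>_. True) M"
      by (simp add: is_arg_min_linorder)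
  qed
  ultimately show ?thesis by blast
qed

end
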